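(* Let $n,m\in\{1,2,\dots\}$, $A\in\mathbb R^{n\times n}$, $B\in\mathbb R^{n\times m}\setminus\{0\}$ and $x_0\in\mathbb R^n\setminus\{0\}$. Assume that the time optimal control problem $(\mathcal{TP})_{x_0}$ has an admissible control. Let $\mathbb S_{x_0}$ and $\mathbb D_{x_0}$ be the sets of switching points and of switching directions of its optimal control $u^*_{x_0}$. Assume that $n\ge2$ and $\mathbb S_{x_0}\ne\emptyset$. Then: (i) If $\mathrm{rank}(B)=1$, then $$\mathbb D_{x_0}\subset\left\{\frac{B^\top v}{\|B^\top v\|_{\mathbb R^m}},\,-\frac{B^\top v}{\|B^\top v\|_{\mathbb R^m}}\right\},$$ where $v$ is a unit vector in the one-dimensional space $\ker(B^\top)^\perp$. (ii) If $\mathrm{rank}(B,AB,\dots,A^{n-1}B)=n$ and $\mathrm{rank}(B)=n-1$, then $$\mathbb D_{x_0}\subset\left\{\frac{B^\top A^\top v}{\|B^\top A^\top v\|_{\mathbb R^m}},\,-\frac{B^\top A^\top v}{\|B^\top A^\top v\|_{\mathbb R^m}}\right\},$$ where $v$ is a unit vector in the one-dimensional space $\ker(B^\top)$.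
   Context: Notation: $\mathbb R^+=(0,+\infty)$; $B_1(0)$ is the closed unit ball of $\mathbb R^m$ (Euclidean norm) centered at $0$ and $\partial B_1(0)$ its boundary; $\perp$ denotes orthogonal complement in $\mathbb R^n$. $\mathcal{PC}(\mathbb R^+;E)$ (with $\emptyset\ne E\subset\mathbb R^m$) is the set of all piecewise continuous and left continuous functions $\mathbb R^+\to E$ with finitely many discontinuities. Control system: for $u\in\mathcal{PC}(\mathbb R^+;\mathbb R^m)$, $x(\cdot;x_0,u)$ is the solution of $x'(t)=Ax(t)+Bu(t)$, $t\ge0$, $x(0)=x_0$. Problem $(\mathcal{TP})_{x_0}$: $T^*_{x_0}=\inf\{\hat t>0:\exists u\in\mathcal{PC}(\mathbb R^+;B_1(0))\text{ s.t. }x(\hat t;x_0,u)=0\}$ is the optimal time. A control $u\in\mathcal{PC}(\mathbb R^+;B_1(0))$ is admissible if $x(\hat t;x_0,u)=0$ for some $\hat t>0$. A control $u^*_{x_0}\in\mathcal{PC}(\mathbb R^+;B_1(0))$ is an optimal control if $x(T^*_{x_0};x_0,u^*_{x_0})=0$ and $u^*_{x_0}(t)=0$ for all $t>T^*_{x_0}$. When an admissible control exists, $0<T^*_{x_0}<+\infty$ and there is exactly one optimal control, denoted $u^*_{x_0}$. A switching point of $u^*_{x_0}$ is a discontinuity $\hat t$ of $u^*_{x_0}$, i.e. $u^*_{x_0}(\hat t)=\lim_{t\to\hat t^-}u^*_{x_0}(t)\ne\lim_{t\to\hat t^+}u^*_{x_0}(t)$; $\mathbb S_{x_0}$ is the set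 of all switching points lying in $(0,T^*_{x_0})$. When $\mathbb S_{x_0}\neq\emptyset$, the set of switching directions is $\mathbb D_{x_0}=\{v\in\partial B_1(0):\exists\hat t\in\mathbb S_{x_0}\text{ s.t. }\lim_{t\to\hat t^-}u^*_{x_0}(t)=v\}$. Under the respective hypotheses, the quotients in (i) and (ii) are well defined (the denominators are nonzero). *)

theory Defs
  imports "HOL-Analysis.Analysis"
begin

text \<open>
  A function on the open half-line \<open>(0,\<infinity>)\<close> is represented by a function on all of \<open>real\<close>;
  its values at nonpositive times play no role. Being piecewise continuous
  includes the existence of a finite right limit at every point of \<open>(0,\<infinity>)\<close>; nothing is required of
  the limits at the ends \<open>0\<close> and \<open>\<infinity>\<close>.
\<close>

definition PC :: "(real^'m) set \<Rightarrow> (real \<Rightarrow> real^'m) set" where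
  "PC E = {u. (\<forall>t>0. u t \<in> E) \<and>
              (\<forall>t>0. (u \<longlongrightarrow> u t) (at_left t)) \<and>
              (\<forall>t>0. \<exists>r. (u \<longlongrightarrow> r) (at_right t)) \<and>
              finite {t. 0 < t \<and> \<not> isCont u t}}"

text \<open>
  For piecewise continuous \<open>u\<close> a solution of \<open>x' = A x + B u\<close> is a continuous function satisfying the
  equation at the points of continuity of \<open>u\<close>. Since there are only finitely many other points, it is
  unique on \<open>[0,\<infinity>)\<close>, so that the existential quantifier over \<open>x\<close> in \<open>steers_to_zero\<close> only
  serves to name the solution with initial value \<open>x0\<close> and control \<open>u\<close>.
\<close>

definition is_solution ::
  "real^'n^'n \<Rightarrow> real^'m^'n \<Rightarrow> real^'n \<Rightarrow> (real \<Rightarrow> real^'m) \<Rightarrow> (real \<Rightarrow> real^'n) \<Rightarrow> bool" where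
  "is_solution A B x0 u x \<longleftrightarrow>
     continuous_on {0..} x \<and> x 0 = x0 \<and>
     (\<forall>t>0. isCont u t \<longrightarrow> (x has_vector_derivative (A *v x t + B *v u t)) (at t))"

definition steers_to_zero ::
  "real^'n^'n \<Rightarrow> real^'m^'n \<Rightarrow> real^'n \<Rightarrow> (real \<Rightarrow> real^'m) \<Rightarrow> real \<Rightarrow> bool" where
  "steers_to_zero A B x0 u t \<longleftrightarrow> (\<exists>x. is_solution A B x0 u x \<and> x t = 0)"

definition admissible_control ::
  "real^'n^'n \<Rightarrow> real^'m^'n \<Rightarrow> real^'n \<Rightarrow> (real \<Rightarrow> real^'m) \<Rightarrow> bool" where
  "admissible_control A B x0 u \<longleftrightarrow> u \<in> PC (cball 0 1) \<and> (\<exists>t>0. steers_to_zero A B x0 u t)"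

definition optimal_time :: "real^'n^'n \<Rightarrow> real^'m^'n \<Rightarrow> real^'n \<Rightarrow> real" where
  "optimal_time A B x0 = Inf {t. 0 < t \<and> (\<exists>u \<in> PC (cball 0 1). steers_to_zero A B x0 u t)}"

definition optimal_control ::
  "real^'n^'n \<Rightarrow> real^'m^'n \<Rightarrow> real^'n \<Rightarrow> (real \<Rightarrow> real^'m) \<Rightarrow> bool" where
  "optimal_control A B x0 u \<longleftrightarrow>
     u \<in> PC (cball 0 1) \<and>
     steers_to_zero A B x0 u (optimal_time A B x0) \<and>
     (\<forall>t > optimal_time A B x0. u t = 0)"

definition switching_point :: "(real \<Rightarrow> real^'m) \<Rightarrow> real \<Rightarrow> bool" where
  "switching_point u t \<longleftrightarrow>
     (u \<longlongrightarrow> u t) (at_left t) \<and> (\<exists>r. (u \<longlongrightarrow> r) (at_right t) \<and> u t \<noteq> r)"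

text \<open>In the next two definitions \<open>T\<close> is the optimal time and \<open>u\<close> the optimal control.\<close>

definition switching_points :: "real \<Rightarrow> (real \<Rightarrow> real^'m) \<Rightarrow> real set" where
  "switching_points T u = {t \<in> {0<..<T}. switching_point u t}"

definition switching_directions :: "real \<Rightarrow> (real \<Rightarrow> real^'m) \<Rightarrow> (real^'m) set" where
  "switching_directions T u =
     {v \<in> sphere 0 1. \<exists>t \<in> switching_points T u. (u \<longlongrightarrow> v) (at_left t)}"

definition ker :: "real^'a^'b \<Rightarrow> (real^'a) set" where
  "ker M = {w. M *v w = 0}"

text \<open>
  The block matrix \<open>(B, AB, \<dots>, A\<^sup>n\<^sup>-\<^sup>1B)\<close>. Its columns are indexed by pairs of a block index in \<open>'n\<close>
  and a column index in \<open>'m\<close>; the \<open>n\<close> elements of \<open>'n\<close> are numbered \<open>0, \<dots>, n - 1\<close> by the bijection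
  \<open>to_nat_on UNIV\<close>, and another numbering would merely permute the blocks. The powers are iterated
  matrix products: the overloaded \<open>*\<close> and \<open>^\<close> on \<open>real^'n^'n\<close> are componentwise.
\<close>

definition kalman_matrix :: "real^'n^'n \<Rightarrow> real^'m^'n \<Rightarrow> real^('n \<times> 'm)^'n" where
  "kalman_matrix A B =
     (\<chi> i p. (((\<lambda>M. A ** M) ^^ to_nat_on (UNIV :: 'n set) (fst p)) B) $ i $ snd p)"

lemma columns_kalman_matrix:
  fixes A :: "real^'n^'n" and B :: "real^'m^'n"
  shows "columns (kalman_matrix A B) = (\<Union>k<CARD('n). columns (((\<lambda>M. A ** M) ^^ k) B))"
proof -
  have img: "to_nat_on (UNIV :: 'n set) ` UNIV = {..<CARD('n)}"
    using to_nat_on_finite[of "UNIV :: 'n set"] by (simp add: bij_betw_def)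
  have col: "column (j, l) (kalman_matrix A B) =
      column l (((\<lambda>M. A ** M) ^^ to_nat_on (UNIV :: 'n set) j) B)" for j l
    by (simp add: column_def kalman_matrix_def)
  have "columns (kalman_matrix A B) =
      (\<Union>j. columns (((\<lambda>M. A ** M) ^^ to_nat_on (UNIV :: 'n set) j) B))"
    by (auto simp: columns_def col)
  also have "\<dots> = (\<Union>k \<in> to_nat_on (UNIV :: 'n set) ` UNIV. columns (((\<lambda>M. A ** M) ^^ k) B))"
    by simp
  finally show ?thesis
    unfolding img .
qed

end

theory Submission
  imports Defs
begin

text \<open>
  The theorem follows from Pontryagin's maximum principle. By variation of constants, a control \<open>w\<close>
  steers \<open>x0\<close> to the origin at time \<open>t\<close> iff its steering vector, the integral of
  \<open>mexp A (- s) *v (B *v w s)\<close> over \<open>[0, t]\<close>, equals \<open>- x0\<close> (\<open>steers_to_zero_iff\<close>). For each time before the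
  optimal time \<open>T\<close>, the steering vectors form a convex set that does not contain \<open>- x0\<close>. Separating
  hyperplanes converge to a hyperplane that supports the steering vectors of time \<open>T\<close> at \<open>- x0\<close>
  (\<open>supporting_functional\<close>), and localised variations of the optimal control turn this into a pointwise
  condition. The outcome is \<open>maximum_principle\<close>: for a solution \<open>\<phi>\<close> of the adjoint equation
  \<open>\<phi>' = - A\<^sup>T \<phi>\<close>, the optimal control is \<open>sgn (B\<^sup>T \<phi>(s))\<close> at its points of continuity \<open>s\<close> in \<open>(0, T)\<close> where
  the switching function \<open>B\<^sup>T \<phi>\<close> does not vanish.

  If \<open>rank B = 1\<close>, the system need not be controllable, and \<open>\<phi>\<close> has to be chosen in the span of all
  steering vectors. Then \<open>B\<^sup>T \<phi>\<close> cannot vanish on an interval (\<open>costate_nonzero_on_interval\<close>). So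
  every left limit of the control is a limit of points in the range of \<open>B\<^sup>T\<close>, which is a line spanned by
  \<open>B\<^sup>T v\<close>; a unit vector on this line is one of two.

  In the controllable case with \<open>rank B = n - 1\<close>, the switching function vanishes at each switching time
  \<open>t\<close>, because elsewhere \<open>sgn (B\<^sup>T \<phi>)\<close> is continuous. Hence \<open>\<phi>(t) = c v\<close> with \<open>c \<noteq> 0\<close>, where \<open>v\<close> spans the
  kernel of \<open>B\<^sup>T\<close>, and the derivative of the switching function at \<open>t\<close> is \<open>- c B\<^sup>T A\<^sup>T v\<close>. Controllability
  makes it nonzero (\<open>controllable_imp_transpose_nonzero\<close>), so that the control tends to
  \<open>sgn (c B\<^sup>T A\<^sup>T v)\<close> from the left.
\<close>

section \<open>Matrix products as bounded bilinear maps\<close>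

lemma bounded_bilinear_matrix_vector_mult:
  "bounded_bilinear ((*v) :: real^'n^'m \<Rightarrow> real^'n \<Rightarrow> real^'m)"
  unfolding bilinear_conv_bounded_bilinear[symmetric] bilinear_def linear_iff
  by (simp add: matrix_vector_mult_def vec_eq_iff algebra_simps sum.distrib sum_distrib_left)

lemma bounded_bilinear_matrix_matrix_mult:
  "bounded_bilinear ((**) :: real^'n^'m \<Rightarrow> real^'p^'n \<Rightarrow> real^'p^'m)"
  unfolding bilinear_conv_bounded_bilinear[symmetric] bilinear_def linear_iff
  by (simp add: matrix_matrix_mult_def vec_eq_iff algebra_simps sum.distrib sum_distrib_left)

lemma bounded_linear_transpose: "bounded_linear (transpose :: real^'n^'m \<Rightarrow> real^'m^'n)"
  unfolding linear_conv_bounded_linear[symmetric] linear_iff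
  by (simp add: transpose_def vec_eq_iff)

text \<open>
  The library rewrites \<open>transpose M *v x\<close> to \<open>x v* M\<close>, which hides compositions such as
  \<open>transpose B *v (transpose A *v v)\<close> from the laws for \<open>*v\<close>.
\<close>

declare transpose_matrix_vector [simp del]

lemmas continuous_matrix_intros =
  bounded_bilinear.continuous_on[OF bounded_bilinear_matrix_vector_mult]
  bounded_bilinear.continuous_on[OF bounded_bilinear_matrix_matrix_mult]

lemmas bounded_linear_matrix_mult_right =
  bounded_bilinear.bounded_linear_right[OF bounded_bilinear_matrix_matrix_mult]
lemmas bounded_linear_matrix_mult_left =
  bounded_bilinear.bounded_linear_left[OF bounded_bilinear_matrix_matrix_mult]
lemmas bounded_linear_matrix_vector_left =
  bounded_bilinear.bounded_linear_left[OF bounded_bilinear_matrix_vector_mult]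
lemmas bounded_linear_matrix_vector_right =
  bounded_bilinear.bounded_linear_right[OF bounded_bilinear_matrix_vector_mult]

section \<open>The matrix exponential\<close>

text \<open>
  The componentwise \<open>*\<close> on matrices makes neither the power \<open>^\<close> nor the function \<open>exp\<close> of Banach
  algebras the right notion, so powers are iterated matrix products and the exponential is their
  series.
\<close>

definition mpow :: "real^'n^'n \<Rightarrow> nat \<Rightarrow> real^'n^'n" where
  "mpow A k = ((\<lambda>M. A ** M) ^^ k) (mat 1)"

lemma mpow_0 [simp]: "mpow A 0 = mat 1"
  and mpow_Suc: "mpow A (Suc k) = A ** mpow A k"
  by (simp_all add: mpow_def)

lemma mpow_Suc_right: "mpow A (Suc k) = mpow A k ** A"
proof (induction k)
  case (Suc k)
  then show ?case
    by (metis mpow_Suc matrix_mul_assoc)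
qed (simp add: mpow_Suc)

lemma funpow_matrix_mult: "((\<lambda>M. A ** M) ^^ k) B = mpow A k ** B"
  by (induction k) (simp_all add: mpow_Suc matrix_mul_assoc)

definition mexp :: "real^'n^'n \<Rightarrow> real \<Rightarrow> real^'n^'n" where
  "mexp A t = (\<Sum>k. (t ^ k / fact k) *\<^sub>R mpow A k)"

lemma norm_mpow_le: "\<exists>K>0. \<forall>k. norm (mpow A k) \<le> K ^ k * norm (mat 1 :: real^'n^'n)"
  for A :: "real^'n^'n"
proof -
  have "bounded_linear ((**) A :: real^'n^'n \<Rightarrow> _)" by (rule bounded_linear_matrix_mult_right)
  then obtain K where K: "K > 0" "\<And>M. norm (A ** M) \<le> norm (M :: real^'n^'n) * K"
    using bounded_linear.pos_bounded by blast
  have "norm (mpow A k) \<le> K ^ k * norm (mat 1 :: real^'n^'n)" for k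
  proof (induction k)
    case (Suc k)
    have "norm (mpow A (Suc k)) \<le> norm (mpow A k) * K" by (simp add: mpow_Suc K)
    also have "\<dots> \<le> (K ^ k * norm (mat 1 :: real^'n^'n)) * K"
      using Suc K(1) by (intro mult_right_mono) auto
    finally show ?case by (simp add: algebra_simps)
  qed simp
  with K show ?thesis by blast
qed

lemma summable_mexp: "summable (\<lambda>k. (t ^ k / fact k) *\<^sub>R mpow A k)"
proof -
  obtain K where K: "K > 0" "\<And>k. norm (mpow A k) \<le> K ^ k * norm (mat 1 :: real^'a^'a)"
    using norm_mpow_le by blast
  have "summable (\<lambda>k. norm (mat 1 :: real^'a^'a) * ((\<bar>t\<bar> * K) ^ k /\<^sub>R fact k))"
    by (intro summable_mult summable_exp_generic)
  moreover have "norm ((t ^ k / fact k) *\<^sub>R mpow A k) \<le>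
      norm (mat 1 :: real^'a^'a) * ((\<bar>t\<bar> * K) ^ k /\<^sub>R fact k)" for k
    using mult_left_mono[OF K(2)[of k], of "\<bar>t\<bar> ^ k / fact k"]
    by (simp add: power_abs power_mult_distrib field_simps)
  ultimately show ?thesis by (rule summable_comparison_test')
qed

text \<open>
  A bounded linear image of the exponential is again a power series; inner products with a basis
  reduce questions on the matrix series to real power series.
\<close>

lemma bounded_linear_mexp:
  assumes "bounded_linear f"
  shows "f (mexp A t) = (\<Sum>k. (t ^ k / fact k) *\<^sub>R f (mpow A k))"
    and "summable (\<lambda>k. (t ^ k / fact k) *\<^sub>R f (mpow A k))"
proof -
  interpret bounded_linear f by fact
  show "f (mexp A t) = (\<Sum>k. (t ^ k / fact k) *\<^sub>R f (mpow A k))"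
    unfolding mexp_def by (subst suminf[OF summable_mexp]) (simp add: scaleR)
  show "summable (\<lambda>k. (t ^ k / fact k) *\<^sub>R f (mpow A k))"
    using summable[OF summable_mexp, of t A] by (simp add: scaleR)
qed

lemma mexp_commute: "A ** mexp A t = mexp A t ** A"
  using bounded_linear_mexp(1)[OF bounded_linear_matrix_mult_right[of A], of A t]
    bounded_linear_mexp(1)[OF bounded_linear_matrix_mult_left[of A], of A t]
  by (simp add: mpow_Suc[symmetric] mpow_Suc_right[symmetric])

lemma mexp_0 [simp]: "mexp A 0 = mat 1"
  unfolding mexp_def by (subst suminf_finite[of "{0}"]) auto

text \<open>
  Coordinatewise this is termwise differentiation of a real power series that converges everywhere.
\<close>

lemma mexp_has_vector_derivative:
  "((\<lambda>t. mexp A t) has_vector_derivative A ** mexp A t) (at t within S)"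
proof -
  have "((\<lambda>t. mexp A t \<bullet> b) has_derivative (\<lambda>h. (h *\<^sub>R (A ** mexp A t)) \<bullet> b)) (at t)" for b
  proof -
    let ?c = "\<lambda>k. (mpow A k \<bullet> b) / fact k"
    have bl: "bounded_linear (\<lambda>M :: real^'a^'a. M \<bullet> b)" by (rule bounded_linear_inner_left)
    have bl2: "bounded_linear (\<lambda>M :: real^'a^'a. (A ** M) \<bullet> b)"
      by (rule bounded_linear_inner_left_comp[OF bounded_linear_matrix_mult_right])
    have "summable (\<lambda>k. ?c k * x ^ k)" for x
      using bounded_linear_mexp(2)[OF bl, of x A] by (simp add: mult.commute)
    then have "((\<lambda>x. \<Sum>k. ?c k * x ^ k) has_real_derivative (\<Sum>k. diffs ?c k * t ^ k)) (at t)"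
      by (rule termdiffs_strong_converges_everywhere)
    moreover have "(\<Sum>k. ?c k * x ^ k) = mexp A x \<bullet> b" for x
      using bounded_linear_mexp(1)[OF bl, of A x] by (simp add: mult.commute)
    moreover have "diffs ?c k = ((A ** mpow A k) \<bullet> b) / fact k" for k
      by (simp add: diffs_def mpow_Suc fact_Suc divide_simps)
    then have "(\<Sum>k. diffs ?c k * t ^ k) = (A ** mexp A t) \<bullet> b"
      using bounded_linear_mexp(1)[OF bl2, of A t] by (simp add: mult.commute)
    ultimately show ?thesis
      by (simp add: has_field_derivative_def mult_commute_abs)
  qed
  then show ?thesis
    unfolding has_vector_derivative_def
    by (subst has_derivative_componentwise_within) (auto intro: has_derivative_at_withinI)
qed

lemma mexp_neg_has_vector_derivative:
  "((\<lambda>t. mexp A (- t)) has_vector_derivative - (mexp A (- t) ** A)) (at t within S)"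
proof -
  have "(uminus has_vector_derivative -1) (at t :: real filter)"
    by (auto intro!: derivative_eq_intros)
  from vector_diff_chain_at[OF this mexp_has_vector_derivative[of A "- t" UNIV]]
  have "((\<lambda>t. mexp A (- t)) has_vector_derivative - (mexp A (- t) ** A)) (at t)"
    by (simp add: o_def mexp_commute)
  then show ?thesis by (rule has_vector_derivative_at_within)
qed

lemma continuous_on_mexp: "continuous_on S (mexp A)"
  using has_vector_derivative_continuous[OF mexp_has_vector_derivative]
  by (auto simp: continuous_on_eq_continuous_within)

text \<open>
  The product has derivative zero in \<open>t\<close>, so that it equals its value at \<open>t = 0\<close>. This form of the
  group law contains the formula for the inverse.
\<close>

lemma mexp_add: "mexp A (- t) ** mexp A (t + s) = mexp A s"
proof -
  let ?f = "\<lambda>t. mexp A (- t) ** mexp A (t + s)"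
  have shift: "((\<lambda>t. t + s) has_vector_derivative 1) (at t)" for t :: real
    by (auto intro!: derivative_eq_intros)
  have d: "((\<lambda>t. mexp A (t + s)) has_vector_derivative A ** mexp A (t + s)) (at t)" for t
    using vector_diff_chain_at[OF shift mexp_has_vector_derivative] by (simp add: o_def)
  \<comment> \<open>The two terms of the product rule cancel because \<open>A\<close> commutes with its exponential.\<close>
  have "(?f has_vector_derivative 0) (at t within UNIV)" for t
    using bounded_bilinear.has_vector_derivative[OF bounded_bilinear_matrix_matrix_mult
        mexp_neg_has_vector_derivative[of A t UNIV] d]
    by (simp add: matrix_mul_assoc bounded_bilinear.minus_left[OF bounded_bilinear_matrix_matrix_mult])
  then obtain c where "\<And>t. ?f t = c"
    using has_vector_derivative_zero_constant[of UNIV ?f] by auto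
  from this[of t] this[of 0] show ?thesis by simp
qed

lemma mexp_inverse: "mexp A (- t) ** mexp A t = mat 1" "mexp A t ** mexp A (- t) = mat 1"
  using mexp_add[of A t 0] mexp_add[of A "- t" 0] by simp_all

section \<open>Piecewise continuous controls\<close>

lemma PC_const: "c \<in> E \<Longrightarrow> (\<lambda>_. c) \<in> PC E"
  by (auto simp: PC_def)

text \<open>
  Constant weights give convexity of the set of controls; localised continuous weights give the
  variations from which the pointwise maximum condition is derived.
\<close>

lemma PC_blend:
  assumes "convex E" and u: "u \<in> PC E" and w: "w \<in> PC E"
    and cont: "continuous_on UNIV \<eta>" and range: "\<And>s. \<eta> s \<in> {0..1}"
  shows "(\<lambda>s. (1 - \<eta> s) *\<^sub>R u s + \<eta> s *\<^sub>R w s) \<in> PC E"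
proof -
  have iso: "isCont \<eta> t" for t
    using cont by (simp add: continuous_on_eq_continuous_at)
  have lim: "(\<eta> \<longlongrightarrow> \<eta> t) (at t within S)" for t S
    using iso[of t] unfolding isCont_def by (rule tendsto_mono[OF at_le, rotated]) simp
  let ?w = "\<lambda>s. (1 - \<eta> s) *\<^sub>R u s + \<eta> s *\<^sub>R w s"
  have "?w t \<in> E" if "t > 0" for t
    using that u w range[of t] \<open>convex E\<close>
    by (intro convexD) (auto simp: PC_def)
  moreover have "(?w \<longlongrightarrow> ?w t) (at_left t)" if "t > 0" for t
    using that u w by (intro tendsto_intros lim) (auto simp: PC_def)
  moreover have "\<exists>r. (?w \<longlongrightarrow> r) (at_right t)" if t: "t > 0" for t
  proof -
    obtain a b where "(u \<longlongrightarrow> a) (at_right t)" "(w \<longlongrightarrow> b) (at_right t)"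
      using u w t unfolding PC_def by blast
    then have "(?w \<longlongrightarrow> (1 - \<eta> t) *\<^sub>R a + \<eta> t *\<^sub>R b) (at_right t)"
      by (intro tendsto_intros lim)
    then show ?thesis ..
  qed
  moreover have "finite {t. 0 < t \<and> \<not> isCont ?w t}"
  proof (rule finite_subset)
    show "{t. 0 < t \<and> \<not> isCont ?w t} \<subseteq>
        {t. 0 < t \<and> \<not> isCont u t} \<union> {t. 0 < t \<and> \<not> isCont w t}"
      using iso by (auto intro!: continuous_intros)
    show "finite ({t. 0 < t \<and> \<not> isCont u t} \<union> {t. 0 < t \<and> \<not> isCont w t})"
      using u w by (simp add: PC_def)
  qed
  ultimately show ?thesis unfolding PC_def by blast
qed

lemma PC_integrable:
  fixes M :: "real \<Rightarrow> real^'m^'n"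
  assumes w: "w \<in> PC E" and "bounded E" and M: "continuous_on UNIV M"
  shows "(\<lambda>s. M s *v w s) integrable_on {0..t}"
proof -
  define F where "F = {s. 0 < s \<and> \<not> isCont w s}"
  let ?S = "{0<..<t} - F"
  let ?f = "\<lambda>s. M s *v w s"
  have "finite F" using w by (simp add: F_def PC_def)
  then have "open ?S" by (simp add: finite_imp_closed open_Diff)
  have "continuous_on ?S w"
    by (intro continuous_at_imp_continuous_on) (auto simp: F_def)
  then have cont: "continuous_on ?S ?f"
    using M by (intro continuous_matrix_intros) (auto intro: continuous_on_subset)
  have lm: "?S \<in> sets lebesgue" using \<open>open ?S\<close> by auto
  obtain K where K: "K > 0" "\<And>(N :: real^'m^'n) x. norm (N *v x) \<le> norm N * norm x * K"
    using bounded_bilinear.pos_bounded[OF bounded_bilinear_matrix_vector_mult] by blast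
  obtain C where C: "\<And>x. x \<in> E \<Longrightarrow> norm x \<le> C"
    using \<open>bounded E\<close> by (auto simp: bounded_iff)
  have gi: "(\<lambda>s. norm (M s) * C * K) integrable_on {0..t}"
    using M by (intro integrable_continuous_real continuous_intros) (auto intro: continuous_on_subset)
  \<comment> \<open>Dropping the finitely many jumps and the endpoints leaves an open set on which the integrand is
      continuous, hence measurable.\<close>
  have neg: "negligible (sym_diff {0..t} ?S)"
    by (rule negligible_subset[of "insert 0 (insert t F)"])
      (use \<open>finite F\<close> in \<open>auto intro: negligible_finite\<close>)
  have "?f integrable_on ?S"
  proof (rule measurable_bounded_by_integrable_imp_integrable)
    show "?f \<in> borel_measurable (lebesgue_on ?S)"
      using cont lm by (rule continuous_imp_measurable_on_sets_lebesgue)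
    show "(\<lambda>s. norm (M s) * C * K) integrable_on ?S"
      by (rule integrable_spike_set[OF gi]) (auto intro: negligible_subset[OF neg])
    show "norm (?f s) \<le> norm (M s) * C * K" if "s \<in> ?S" for s
    proof -
      have "norm (w s) \<le> C" using that w C by (auto simp: PC_def)
      then have "norm (M s) * norm (w s) * K \<le> norm (M s) * C * K"
        using K(1) by (intro mult_right_mono mult_left_mono) auto
      with K(2)[of "M s" "w s"] show ?thesis by linarith
    qed
  qed (fact lm)
  then show ?thesis
    by (rule integrable_spike_set) (auto intro: negligible_subset[OF neg])
qed

section \<open>Steering to the origin as an integral equation\<close>

text \<open>
  By variation of constants, a solution is \<open>mexp A t *v (x0 + steering_vector A B u t)\<close>: the whole
  influence of the control is transported back to time \<open>0\<close>.
\<close>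

definition steering_vector ::
  "real^'n^'n \<Rightarrow> real^'m^'n \<Rightarrow> (real \<Rightarrow> real^'m) \<Rightarrow> real \<Rightarrow> real^'n" where
  "steering_vector A B w t = integral {0..t} (\<lambda>s. mexp A (- s) *v (B *v w s))"

lemma continuous_on_mexp_neg: "continuous_on S (\<lambda>s. mexp A (- s))"
  by (rule continuous_on_compose2[OF continuous_on_mexp[of UNIV]]) (auto intro!: continuous_intros)

lemma steering_integrable:
  assumes "w \<in> PC E" and "bounded E"
  shows "(\<lambda>s. mexp A (- s) *v (B *v w s)) integrable_on {0..t}"
proof -
  have "continuous_on UNIV (\<lambda>s. mexp A (- s) ** B)"
    by (intro continuous_matrix_intros continuous_on_mexp_neg continuous_on_const)
  from PC_integrable[OF assms this, of t] show ?thesis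
    by (simp add: matrix_vector_mul_assoc)
qed

lemma continuous_on_steering_vector:
  assumes "w \<in> PC E" and "bounded E"
  shows "continuous_on {0..} (steering_vector A B w)"
proof -
  have "continuous (at t within {0..}) (steering_vector A B w)" if "t \<ge> 0" for t
  proof -
    have "continuous_on {0..t + 1} (steering_vector A B w)"
      unfolding steering_vector_def
      by (rule indefinite_integral_continuous_1[OF steering_integrable[OF assms]])
    then have "continuous (at t within {0..t + 1}) (steering_vector A B w)"
      using that by (simp add: continuous_on_eq_continuous_within)
    moreover have "at t within {0..t + 1} = at t within {0..}"
      by (rule at_within_nhd[of _ "{..<t+1}"]) auto
    ultimately show ?thesis by (simp add: continuous_within)
  qed
  then show ?thesis by (auto simp: continuous_on_eq_continuous_within)
qed

lemma isCont_matrix_vector: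
  "isCont M s \<Longrightarrow> isCont w s \<Longrightarrow> isCont (\<lambda>s. (M s :: real^'m^'n) *v w s) s"
  by (rule bounded_bilinear.continuous[OF bounded_bilinear_matrix_vector_mult])

lemma isCont_mexp_neg: "isCont (\<lambda>s. mexp A (- s)) t"
  using continuous_on_mexp_neg[of UNIV A] by (simp add: continuous_on_eq_continuous_at)

lemma steering_vector_has_vector_derivative:
  assumes "w \<in> PC E" and "bounded E" and "t > 0" and "isCont w t"
  shows "(steering_vector A B w has_vector_derivative mexp A (- t) *v (B *v w t)) (at t)"
proof -
  let ?f = "\<lambda>s. mexp A (- s) *v (B *v w s)"
  have "isCont ?f t"
    by (intro isCont_matrix_vector isCont_mexp_neg continuous_const assms)
  then have "continuous (at t within {0..t + 1} - {}) ?f"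
    by (simp add: continuous_at_imp_continuous_at_within)
  then have "(steering_vector A B w has_vector_derivative ?f t) (at t within {0..t + 1} - {})"
    unfolding steering_vector_def
    by (intro integral_has_vector_derivative_continuous_at steering_integrable[OF assms(1,2)])
      (use assms in auto)
  moreover have "at t within {0..t + 1} = at t"
    using \<open>t > 0\<close> by (intro at_within_interior) auto
  ultimately show ?thesis by simp
qed

text \<open>
  In one direction the derivative of \<open>mexp A (- s) *v x s\<close> is integrated, in the other the variation of
  constants formula provides a solution.
\<close>

lemma steers_to_zero_iff:
  assumes w: "w \<in> PC E" "bounded E" and "t \<ge> 0"
  shows "steers_to_zero A B x0 w t \<longleftrightarrow> steering_vector A B w t = - x0"
proof
  assume "steers_to_zero A B x0 w t"
  then obtain x where x: "continuous_on {0..} x" "x 0 = x0" "x t = 0"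
    and dx: "\<And>s. s > 0 \<Longrightarrow> isCont w s \<Longrightarrow> (x has_vector_derivative (A *v x s + B *v w s)) (at s)"
    by (auto simp: steers_to_zero_def is_solution_def)
  have "((\<lambda>s. mexp A (- s) *v (B *v w s)) has_integral
      mexp A (- t) *v x t - mexp A (- 0) *v x 0) {0..t}"
  proof (rule fundamental_theorem_of_calculus_interior_strong)
    show "finite {s. 0 < s \<and> \<not> isCont w s}" using w by (simp add: PC_def)
    show "continuous_on {0..t} (\<lambda>s. mexp A (- s) *v x s)"
      by (intro continuous_matrix_intros continuous_on_mexp_neg continuous_on_subset[OF x(1)]) auto
    fix s assume "s \<in> {0<..<t} - {s. 0 < s \<and> \<not> isCont w s}"
    then have "(x has_vector_derivative (A *v x s + B *v w s)) (at s)" by (auto intro: dx)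
    from bounded_bilinear.has_vector_derivative[OF bounded_bilinear_matrix_vector_mult
        mexp_neg_has_vector_derivative[of A s UNIV] this]
    show "((\<lambda>s. mexp A (- s) *v x s) has_vector_derivative mexp A (- s) *v (B *v w s)) (at s)"
      by (simp add: matrix_vector_right_distrib matrix_vector_mul_assoc
          bounded_bilinear.minus_left[OF bounded_bilinear_matrix_vector_mult])
  qed fact
  then show "steering_vector A B w t = - x0"
    by (simp add: steering_vector_def x integral_unique)
next
  assume eq: "steering_vector A B w t = - x0"
  define x where "x = (\<lambda>s. mexp A s *v (x0 + steering_vector A B w s))"
  have "is_solution A B x0 w x"
    unfolding is_solution_def
  proof (intro conjI allI impI)
    show "continuous_on {0..} x"
      unfolding x_def
      by (intro continuous_matrix_intros continuous_on_mexp continuous_on_add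
          continuous_on_const continuous_on_steering_vector[OF w])
    show "x 0 = x0" by (simp add: x_def steering_vector_def)
    fix s :: real assume "s > 0" and "isCont w s"
    then have "((\<lambda>s. x0 + steering_vector A B w s) has_vector_derivative
        mexp A (- s) *v (B *v w s)) (at s)"
      using has_vector_derivative_add[OF has_vector_derivative_const
          steering_vector_has_vector_derivative[OF w, of s]] by simp
    from bounded_bilinear.has_vector_derivative[OF bounded_bilinear_matrix_vector_mult
        mexp_has_vector_derivative[of A s UNIV] this]
    show "(x has_vector_derivative A *v x s + B *v w s) (at s)"
      by (simp add: x_def matrix_vector_mul_assoc mexp_inverse matrix_mul_assoc add.commute)
  qed
  moreover have "x t = 0" using eq by (simp add: x_def)
  ultimately show "steers_to_zero A B x0 w t" by (auto simp: steers_to_zero_def)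
qed

section \<open>The maximum principle\<close>

text \<open>
  Separation relative to a subspace: without controllability the reachable sets have empty interior,
  and a normal orthogonal to all of them would carry no information.
\<close>

lemma separating_unit_vector_in_subspace:
  fixes S :: "'a::euclidean_space set"
  assumes "convex S" "S \<noteq> {}" "z \<notin> S" "subspace R" "S \<subseteq> R" "z \<in> R"
  obtains \<phi> where "\<phi> \<in> R" "norm \<phi> = 1" "\<And>k. k \<in> S \<Longrightarrow> \<phi> \<bullet> k \<le> \<phi> \<bullet> z"
proof -
  obtain a b where a: "z + a \<in> affine hull (insert z S)" "a \<noteq> 0" "a \<bullet> z \<le> b"
    "\<And>x. x \<in> S \<Longrightarrow> b \<le> a \<bullet> x"
    using separating_hyperplane_set_point_inaff[OF assms(1-3)] by blast
  have "affine hull (insert z S) \<subseteq> R"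
    using assms by (intro hull_minimal subspace_imp_affine) auto
  then have "(z + a) - z \<in> R"
    using a(1) assms by (intro subspace_diff[of R]) auto
  then have "a \<in> R" by simp
  show ?thesis
  proof
    show "- (a /\<^sub>R norm a) \<in> R"
      using \<open>a \<in> R\<close> \<open>subspace R\<close> by (simp add: subspace_neg subspace_scale)
    show "norm (- (a /\<^sub>R norm a)) = 1" using a(2) by simp
    show "- (a /\<^sub>R norm a) \<bullet> k \<le> - (a /\<^sub>R norm a) \<bullet> z" if "k \<in> S" for k
    proof -
      have "a \<bullet> z \<le> a \<bullet> k" using a(3) a(4)[OF that] by linarith
      then show ?thesis by (simp add: divide_right_mono divide_inverse_commute[symmetric])
    qed
  qed
qed

text \<open>
  Spanning by steering vectors rather than by the columns of the matrices \<open>A\<^sup>k B\<close> makes it evident that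
  \<open>- x0\<close> belongs to this space whenever \<open>x0\<close> can be steered to the origin.
\<close>

definition reachable_space :: "real^'n^'n \<Rightarrow> real^'m^'n \<Rightarrow> (real^'n) set" where
  "reachable_space A B = span {steering_vector A B w t | w t. w \<in> PC (cball 0 1) \<and> t > 0}"

lemma steering_vector_in_reachable_space:
  "w \<in> PC (cball 0 1) \<Longrightarrow> t > 0 \<Longrightarrow> steering_vector A B w t \<in> reachable_space A B"
  unfolding reachable_space_def by (intro span_base) auto

lemma convex_steering_vectors: "convex ((\<lambda>w. steering_vector A B w t) ` PC (cball 0 1))"
proof (clarsimp simp: convex_alt)
  fix u w :: "real \<Rightarrow> real^'b" and c :: real
  assume uw: "u \<in> PC (cball 0 1)" "w \<in> PC (cball 0 1)" and c: "0 \<le> c" "c \<le> 1"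
  let ?v = "\<lambda>s. (1 - c) *\<^sub>R u s + c *\<^sub>R w s"
  have "?v \<in> PC (cball 0 1)"
    using uw c by (intro PC_blend[of _ _ _ "\<lambda>_. c"]) auto
  moreover have "steering_vector A B ?v t =
      (1 - c) *\<^sub>R steering_vector A B u t + c *\<^sub>R steering_vector A B w t"
  proof -
    have "((\<lambda>s. (1 - c) *\<^sub>R (mexp A (- s) *v (B *v u s)) + c *\<^sub>R (mexp A (- s) *v (B *v w s)))
        has_integral (1 - c) *\<^sub>R steering_vector A B u t + c *\<^sub>R steering_vector A B w t) {0..t}"
      unfolding steering_vector_def
      by (intro has_integral_add has_integral_cmul integrable_integral
          steering_integrable[OF uw(1) bounded_cball] steering_integrable[OF uw(2) bounded_cball])
    moreover have "mexp A (- s) *v (B *v ?v s) =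
        (1 - c) *\<^sub>R (mexp A (- s) *v (B *v u s)) + c *\<^sub>R (mexp A (- s) *v (B *v w s))" for s
      by (simp only: matrix_vector_right_distrib matrix_vector_mult_scaleR)
    ultimately show ?thesis
      unfolding steering_vector_def[of A B ?v] by (simp only: integral_unique)
  qed
  ultimately show "(1 - c) *\<^sub>R steering_vector A B u t + c *\<^sub>R steering_vector A B w t
      \<in> (\<lambda>w. steering_vector A B w t) ` PC (cball 0 1)"
    by (intro image_eqI) auto
qed

lemma not_steered_before_optimal_time:
  assumes "w \<in> PC (cball 0 1)" "0 < t" "t < optimal_time A B x0"
  shows "\<not> steers_to_zero A B x0 w t"
proof
  assume "steers_to_zero A B x0 w t"
  then have "optimal_time A B x0 \<le> t"
    unfolding optimal_time_def using assms by (intro cInf_lower bdd_belowI[of _ 0]) auto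
  with assms show False by simp
qed

text \<open>
  Before the optimal time \<open>T\<close> the vector \<open>- x0\<close> lies outside the convex set of steering vectors and
  can be separated from it. By compactness of the unit sphere, a subsequence of the normals for times
  \<open>t n\<close> increasing to \<open>T\<close> converges, and continuity of steering vectors in time carries the inequality
  over to \<open>T\<close>, where \<open>- x0\<close> is the steering vector of the optimal control.
\<close>

lemma supporting_functional:
  assumes u: "optimal_control A B x0 u" and T: "optimal_time A B x0 > 0" (is "?T > 0")
  obtains \<phi> where "\<phi> \<in> reachable_space A B" "norm \<phi> = 1"
    "\<And>w. w \<in> PC (cball 0 1) \<Longrightarrow> \<phi> \<bullet> steering_vector A B w ?T \<le> \<phi> \<bullet> steering_vector A B u ?T"
proof -
  let ?R = "reachable_space A B" and ?PC = "PC (cball 0 1) :: (real \<Rightarrow> real^'b) set"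
  have R: "subspace ?R" by (simp add: reachable_space_def)
  have uPC: "u \<in> ?PC" and "steers_to_zero A B x0 u ?T"
    using u unfolding optimal_control_def by blast+
  then have ux0: "steering_vector A B u ?T = - x0"
    using steers_to_zero_iff[OF uPC bounded_cball less_imp_le[OF T]] by blast
  then have x0R: "- x0 \<in> ?R"
    using steering_vector_in_reachable_space[OF uPC T, of A B] by simp
  define t where "t n = ?T * (real (Suc n) / real (Suc (Suc n)))" for n
  have t: "0 < t n" "t n < ?T" for n
  proof -
    let ?r = "real (Suc n) / real (Suc (Suc n))"
    have r: "0 < ?r" "?r < 1" by simp_all
    show "0 < t n" unfolding t_def by (rule mult_pos_pos[OF T r(1)])
    have "?T * ?r < ?T * 1" by (rule mult_strict_left_mono[OF r(2) T])
    then show "t n < ?T" unfolding t_def by (simp only: mult_1_right)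
  qed
  have t_lim: "t \<longlonglongrightarrow> ?T"
    using tendsto_mult[OF tendsto_const[where k="?T"] LIMSEQ_Suc[OF LIMSEQ_n_over_Suc_n]]
    by (simp add: t_def[abs_def] del: of_nat_Suc)
  have "\<exists>\<phi>. \<phi> \<in> ?R \<and> norm \<phi> = 1 \<and> (\<forall>w \<in> ?PC. \<phi> \<bullet> steering_vector A B w (t n) \<le> \<phi> \<bullet> (- x0))" for n
  proof -
    let ?K = "(\<lambda>w. steering_vector A B w (t n)) ` ?PC"
    have "?K \<noteq> {}" using uPC by blast
    moreover have "- x0 \<notin> ?K"
    proof
      assume "- x0 \<in> ?K"
      then obtain w where w: "w \<in> ?PC" "steering_vector A B w (t n) = - x0" by fastforce
      then have "steers_to_zero A B x0 w (t n)"
        using steers_to_zero_iff[OF w(1) bounded_cball less_imp_le[OF t(1)]] by blast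
      with not_steered_before_optimal_time[OF w(1) t] show False by blast
    qed
    moreover have "?K \<subseteq> ?R" using steering_vector_in_reachable_space t by blast
    ultimately obtain \<phi> where "\<phi> \<in> ?R" "norm \<phi> = 1" "\<And>k. k \<in> ?K \<Longrightarrow> \<phi> \<bullet> k \<le> \<phi> \<bullet> (- x0)"
      by (rule separating_unit_vector_in_subspace[OF convex_steering_vectors _ _ R _ x0R]) blast
    then show ?thesis by blast
  qed
  then obtain f where f: "\<And>n. f n \<in> ?R" "\<And>n. norm (f n) = 1"
    "\<And>n w. w \<in> ?PC \<Longrightarrow> f n \<bullet> steering_vector A B w (t n) \<le> f n \<bullet> (- x0)"
    by metis
  \<comment> \<open>A limit of normals separating at times before the optimal one supports at the optimal time;
      normalisation within the closed subspace keeps it nonzero.\<close>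
  have "compact (sphere 0 1 \<inter> ?R)"
    by (simp add: compact_Int_closed closed_subspace R)
  then obtain \<phi> r where \<phi>: "\<phi> \<in> sphere 0 1 \<inter> ?R" "strict_mono r" "(f \<circ> r) \<longlonglongrightarrow> \<phi>"
    using f unfolding compact_def by (metis (no_types, lifting) IntI mem_sphere_0)
  have tr: "(t \<circ> r) \<longlonglongrightarrow> ?T" using t_lim \<phi>(2) by (rule LIMSEQ_subseq_LIMSEQ)
  show ?thesis
  proof
    show "\<phi> \<in> ?R" "norm \<phi> = 1" using \<phi>(1) by auto
    fix w assume w: "w \<in> ?PC"
    have "(\<lambda>n. steering_vector A B w ((t \<circ> r) n)) \<longlonglongrightarrow> steering_vector A B w ?T"
      using t T by (intro continuous_on_tendsto_compose[OF
            continuous_on_steering_vector[OF w bounded_cball] tr]) (auto simp: less_imp_le)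
    then have l: "(\<lambda>n. (f \<circ> r) n \<bullet> steering_vector A B w ((t \<circ> r) n)) \<longlonglongrightarrow> \<phi> \<bullet> steering_vector A B w ?T"
      by (intro tendsto_inner \<phi>(3))
    have "(\<lambda>n. (f \<circ> r) n \<bullet> (- x0)) \<longlonglongrightarrow> \<phi> \<bullet> (- x0)"
      by (intro tendsto_inner \<phi>(3) tendsto_const)
    from LIMSEQ_le[OF l this] f(3)[OF w]
    show "\<phi> \<bullet> steering_vector A B w ?T \<le> \<phi> \<bullet> steering_vector A B u ?T"
      by (auto simp: ux0)
  qed
qed

text \<open>
  The solution of the adjoint equation \<open>\<phi>' = - A\<^sup>T \<phi>\<close> with initial value \<open>\<phi>\<close>. Its image under
  \<open>transpose B\<close> is the switching function.
\<close>

definition costate :: "real^'n^'n \<Rightarrow> real^'n \<Rightarrow> real \<Rightarrow> real^'n" where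
  "costate A \<phi> t = transpose (mexp A (- t)) *v \<phi>"

lemma inner_transpose: "(transpose M *v x) \<bullet> y = x \<bullet> (M *v y)" for M :: "real^'n^'m"
  by (simp add: dot_lmul_matrix transpose_matrix_vector)

lemma inner_costate: "costate A \<phi> t \<bullet> y = \<phi> \<bullet> (mexp A (- t) *v y)"
  by (simp add: costate_def inner_transpose)

lemma costate_has_vector_derivative:
  "(costate A \<phi> has_vector_derivative - (transpose A *v costate A \<phi> t)) (at t within S)"
proof -
  have "(costate A \<phi> has_vector_derivative transpose (- (mexp A (- t) ** A)) *v \<phi>) (at t within S)"
    unfolding costate_def
    by (intro bounded_linear.has_vector_derivative[OF bounded_linear_matrix_vector_left]
        bounded_linear.has_vector_derivative[OF bounded_linear_transpose]
        mexp_neg_has_vector_derivative)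
  then show ?thesis
    by (simp add: costate_def linear_neg[OF bounded_linear.linear[OF bounded_linear_transpose]]
        bounded_bilinear.minus_left[OF bounded_bilinear_matrix_vector_mult]
        matrix_transpose_mul matrix_vector_mul_assoc)
qed

lemma isCont_costate: "isCont (costate A \<phi>) t"
  using has_vector_derivative_continuous[OF costate_has_vector_derivative] .

text \<open>
  If \<open>z\<close> gave a larger value than \<open>u s\<close>, then by continuity it would do so on a neighbourhood of \<open>s\<close>, and
  moving \<open>u\<close> towards \<open>z\<close> there would increase the functional that \<open>u\<close> maximises.
\<close>

lemma pointwise_maximum:
  assumes u: "u \<in> PC (cball 0 1)"
    and max: "\<And>w. w \<in> PC (cball 0 1) \<Longrightarrow> \<phi> \<bullet> steering_vector A B w T \<le> \<phi> \<bullet> steering_vector A B u T"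
    and s: "0 < s" "s < T" "isCont u s" and z: "norm z \<le> 1"
  shows "(transpose B *v costate A \<phi> s) \<bullet> z \<le> (transpose B *v costate A \<phi> s) \<bullet> u s"
proof (rule ccontr)
  define g where "g = (\<lambda>s. (transpose B *v costate A \<phi> s) \<bullet> (z - u s))"
  assume "\<not> ?thesis"
  then have "g s > 0" by (simp add: g_def inner_diff_right)
  have "isCont g s"
    unfolding g_def
    by (intro continuous_inner isCont_matrix_vector continuous_const isCont_costate
        continuous_diff s)
  then have "(g \<longlongrightarrow> g s) (nhds s)"
    by (simp add: continuous_at tendsto_at_iff_tendsto_nhds)
  then have "eventually (\<lambda>r. g r > g s / 2) (nhds s)"
    using \<open>g s > 0\<close> by (intro order_tendstoD) auto
  then obtain h where h: "h > 0" "\<And>r. \<bar>r - s\<bar> < h \<Longrightarrow> g r > g s / 2"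
    by (auto simp: eventually_nhds_metric dist_real_def)
  \<comment> \<open>Hat function concentrated where \<open>z\<close> beats \<open>u\<close>: blending by a continuous weight instead of
      switching over to \<open>z\<close> on an interval creates no new discontinuities.\<close>
  define \<eta> where "\<eta> = (\<lambda>r. max 0 (1 - \<bar>r - s\<bar> / h))"
  have \<eta>_cont: "continuous_on S \<eta>" for S
    unfolding \<eta>_def using h(1) by (intro continuous_intros) auto
  have \<eta>_range: "\<eta> r \<in> {0..1}" for r
    using h(1) by (auto simp: \<eta>_def)
  let ?w = "\<lambda>r. (1 - \<eta> r) *\<^sub>R u r + \<eta> r *\<^sub>R z"
  have w: "?w \<in> PC (cball 0 1)"
    using z by (intro PC_blend[OF convex_cball u PC_const \<eta>_cont \<eta>_range]) auto
  let ?F = "\<lambda>v r. mexp A (- r) *v (B *v v r)"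
  have int: "?F u integrable_on {0..T}" "?F ?w integrable_on {0..T}"
    using steering_integrable[OF u bounded_cball] steering_integrable[OF w bounded_cball] by auto
  have eq: "\<phi> \<bullet> (?F ?w r - ?F u r) = \<eta> r * g r" for r
  proof -
    have "?F ?w r - ?F u r = \<eta> r *\<^sub>R (mexp A (- r) *v (B *v (z - u r)))"
      by (simp add: matrix_vector_right_distrib matrix_vector_mult_scaleR
          matrix_vector_mult_diff_distrib algebra_simps)
    then show ?thesis
      by (simp add: g_def inner_transpose inner_costate)
  qed
  have "((\<lambda>r. \<phi> \<bullet> (?F ?w r - ?F u r)) has_integral
      \<phi> \<bullet> (steering_vector A B ?w T - steering_vector A B u T)) {0..T}"
    unfolding steering_vector_def
    using has_integral_linear[OF has_integral_diff[OF int(2,1)[THEN integrable_integral]]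
        bounded_linear_inner_right]
    by (simp add: o_def)
  then have upper: "((\<lambda>r. \<eta> r * g r) has_integral
      \<phi> \<bullet> (steering_vector A B ?w T - steering_vector A B u T)) {0..T}"
    by (simp only: eq)
  have lower: "((\<lambda>r. \<eta> r * (g s / 2)) has_integral integral {0..T} \<eta> * (g s / 2)) {0..T}"
    by (intro has_integral_mult_left integrable_integral integrable_continuous_real \<eta>_cont)
  have le: "\<eta> r * (g s / 2) \<le> \<eta> r * g r" for r
  proof (cases "\<bar>r - s\<bar> < h")
    case True
    then show ?thesis using h(2)[OF True] \<eta>_range[of r] by (intro mult_left_mono) auto
  next
    case False
    then have "\<eta> r = 0" using h(1) by (auto simp: \<eta>_def field_simps)
    then show ?thesis by simp
  qed
  have "integral {0..T} \<eta> * (g s / 2) \<le>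
      \<phi> \<bullet> (steering_vector A B ?w T - steering_vector A B u T)"
    by (rule has_integral_le[OF lower upper le])
  moreover have "integral {0..T} \<eta> > 0"
  proof -
    have "integral {0..T} \<eta> \<ge> 0"
      using \<eta>_range by (intro integral_nonneg integrable_continuous_real \<eta>_cont) auto
    moreover have "integral {0..T} \<eta> \<noteq> 0"
    proof
      assume "integral {0..T} \<eta> = 0"
      then have "\<forall>r \<in> {0..T}. \<eta> r = 0"
        using \<eta>_range s by (subst (asm) integral_eq_0_iff[OF \<eta>_cont]) auto
      then have "\<eta> s = 0" using s by auto
      then show False by (simp add: \<eta>_def)
    qed
    ultimately show ?thesis by simp
  qed
  then have "0 < integral {0..T} \<eta> * (g s / 2)"
    using \<open>g s > 0\<close> by simp
  ultimately have "0 < \<phi> \<bullet> (steering_vector A B ?w T - steering_vector A B u T)"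
    by linarith
  then show False
    using max[OF w] by (simp add: inner_diff_right)
qed

text \<open>
  This is the case of equality in the Cauchy--Schwarz inequality.
\<close>

lemma eq_sgn_if_inner_ge_norm:
  assumes "q \<noteq> 0" "norm v \<le> 1" "norm q \<le> q \<bullet> v"
  shows "v = sgn q"
proof -
  have "q \<bullet> v \<le> norm q * norm v" by (rule norm_cauchy_schwarz)
  also have "\<dots> \<le> norm q" using assms(2) by (simp add: mult_left_le)
  finally have 1: "q \<bullet> v = norm q" using assms(3) by simp
  with \<open>q \<bullet> v \<le> norm q * norm v\<close> assms have "norm v = 1" by simp
  with 1 have "norm q *\<^sub>R v = norm v *\<^sub>R q"
    by (subst norm_cauchy_schwarz_eq[symmetric]) simp
  with \<open>norm v = 1\<close> have "norm q *\<^sub>R v = q" by simp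
  with \<open>q \<noteq> 0\<close> show ?thesis
    by (metis sgn_div_norm scaleR_scaleR left_inverse norm_eq_zero scaleR_one)
qed

text \<open>
  Wherever the switching function does not vanish, its direction is the unique maximiser over the
  unit ball of the inner product with it, and the optimal control has to take this value.
\<close>

lemma maximum_principle:
  assumes u: "optimal_control A B x0 u" and T: "optimal_time A B x0 > 0"
  obtains \<phi> where "\<phi> \<in> reachable_space A B" "\<phi> \<noteq> 0"
    "\<And>s. \<lbrakk>0 < s; s < optimal_time A B x0; isCont u s; transpose B *v costate A \<phi> s \<noteq> 0\<rbrakk> \<Longrightarrow>
      u s = sgn (transpose B *v costate A \<phi> s)"
proof -
  obtain \<phi> where \<phi>: "\<phi> \<in> reachable_space A B" "norm \<phi> = 1"
    and max: "\<And>w. w \<in> PC (cball 0 1) \<Longrightarrow>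
      \<phi> \<bullet> steering_vector A B w (optimal_time A B x0) \<le>
      \<phi> \<bullet> steering_vector A B u (optimal_time A B x0)"
    using supporting_functional[OF u T] by blast
  have uPC: "u \<in> PC (cball 0 1)" using u by (simp add: optimal_control_def)
  show ?thesis
  proof
    show "\<phi> \<in> reachable_space A B" "\<phi> \<noteq> 0" using \<phi> by auto
    fix s let ?q = "transpose B *v costate A \<phi> s"
    assume s: "0 < s" "s < optimal_time A B x0" "isCont u s" and q: "?q \<noteq> 0"
    have "?q \<bullet> sgn ?q \<le> ?q \<bullet> u s"
      using pointwise_maximum[OF uPC max s, of "sgn ?q"] by (simp add: norm_sgn)
    moreover have "?q \<bullet> sgn ?q = norm ?q"
      using q by (simp add: sgn_div_norm power2_norm_eq_inner[symmetric] power2_eq_square)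
    moreover have "norm (u s) \<le> 1" using uPC s(1) by (auto simp: PC_def)
    ultimately show "u s = sgn ?q" using q by (intro eq_sgn_if_inner_ge_norm) auto
  qed
qed

section \<open>Zeros of the switching function\<close>

lemma PC_eventually_isCont:
  assumes "u \<in> PC E" "t > 0"
  shows "eventually (isCont u) (at t)"
proof -
  have "finite {s. 0 < s \<and> \<not> isCont u s}" using assms by (simp add: PC_def)
  then have "eventually (\<lambda>s. s \<notin> {s. 0 < s \<and> \<not> isCont u s}) (at t)"
    using islimpt_finite islimpt_iff_eventually by blast
  moreover have "eventually (\<lambda>s. s > 0) (at t)"
    using order_tendstoD(1)[OF tendsto_ident_at \<open>t > 0\<close>] .
  ultimately show ?thesis by eventually_elim auto
qed

text \<open>
  The inner product of \<open>\<phi>\<close> with a steering vector is the integral of the inner product of the switching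
  function with the control, so that \<open>\<phi>\<close> is orthogonal to the space spanned by the steering vectors.
\<close>

lemma reachable_space_eq_0I:
  assumes "\<phi> \<in> reachable_space A B" and zero: "\<And>s. transpose B *v costate A \<phi> s = 0"
  shows "\<phi> = 0"
proof -
  have "orthogonal \<phi> (steering_vector A B w t)" if w: "w \<in> PC (cball 0 1)" for w t
  proof -
    have "\<phi> \<bullet> (mexp A (- s) *v (B *v w s)) = 0" for s
      by (metis zero inner_costate inner_transpose inner_zero_left)
    moreover have "((\<lambda>s. \<phi> \<bullet> (mexp A (- s) *v (B *v w s))) has_integral
        \<phi> \<bullet> steering_vector A B w t) {0..t}"
      using has_integral_linear[OF integrable_integral[OF
            steering_integrable[OF w bounded_cball, of A B t]] bounded_linear_inner_right[of \<phi>]]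
      by (simp only: steering_vector_def o_def)
    ultimately have "((\<lambda>s. 0) has_integral \<phi> \<bullet> steering_vector A B w t) {0..t}"
      by simp
    then show ?thesis
      unfolding orthogonal_def by (metis has_integral_0 has_integral_unique)
  qed
  then have "orthogonal \<phi> \<phi>"
    using assms(1) unfolding reachable_space_def by (intro orthogonal_to_span[of \<phi>]) auto
  then show ?thesis by (simp add: orthogonal_def)
qed

text \<open>
  Real analyticity in disguise: if the switching function vanishes on an interval, then so do all its
  derivatives there, hence its Taylor series vanishes everywhere, and \<open>\<phi>\<close> is orthogonal to the
  reachable space to which it belongs.
\<close>

lemma costate_nonzero_on_interval:
  assumes "\<phi> \<in> reachable_space A B" "\<phi> \<noteq> 0" "a < b"
  obtains s where "a < s" "s < b" "transpose B *v costate A \<phi> s \<noteq> 0"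
proof (rule ccontr)
  assume "\<not> thesis"
  with that have zero: "transpose B *v costate A \<phi> s = 0" if "s \<in> {a<..<b}" for s
    using that by auto
  \<comment> \<open>The derivative of a function vanishing on an interval vanishes there, and each differentiation of
      the switching function inserts one more factor \<open>A\<close>.\<close>
  have zeros: "transpose (mpow A k ** B) *v costate A \<phi> s = 0" if "s \<in> {a<..<b}" for k s
    using that
  proof (induction k arbitrary: s)
    case 0
    then show ?case using zero by simp
  next
    case (Suc k)
    let ?M = "mpow A k ** B"
    have "((\<lambda>s. transpose ?M *v costate A \<phi> s) has_vector_derivative
        transpose ?M *v (- (transpose A *v costate A \<phi> s))) (at s)"
      by (rule bounded_linear.has_vector_derivative[OF bounded_linear_matrix_vector_right
            costate_has_vector_derivative])
    moreover have "((\<lambda>s. transpose ?M *v costate A \<phi> s) has_vector_derivative 0) (at s)"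
      by (rule has_vector_derivative_transform_within_open[OF has_vector_derivative_const
            open_greaterThanLessThan Suc.prems]) (simp only: Suc.IH)
    ultimately have "transpose ?M *v (- (transpose A *v costate A \<phi> s)) = 0"
      by (rule vector_derivative_unique_at)
    then have "transpose ?M *v (transpose A *v costate A \<phi> s) = 0"
      by (simp only: bounded_bilinear.minus_right[OF bounded_bilinear_matrix_vector_mult]
          neg_equal_0_iff_equal)
    then show ?case
      by (simp only: mpow_Suc matrix_transpose_mul matrix_vector_mul_assoc matrix_mul_assoc[symmetric])
  qed
  define r where "r = (a + b) / 2"
  have r: "r \<in> {a<..<b}" using \<open>a < b\<close> by (simp add: r_def)
  have "transpose B *v costate A \<phi> s = 0" for s
  proof -
    have "(transpose B *v costate A \<phi> s) \<bullet> y = 0" for y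
    proof -
      \<comment> \<open>Expand the exponential around the single time \<open>r\<close>: every term of the series vanishes.\<close>
      have "bounded_linear (\<lambda>M. costate A \<phi> r \<bullet> (M *v (B *v y)))"
        by (intro bounded_linear_inner_right_comp bounded_linear_matrix_vector_left)
      note series = bounded_linear_mexp(1)[OF this]
      have "costate A \<phi> r \<bullet> (mpow A k *v (B *v y)) = 0" for k
        using inner_transpose[of "mpow A k ** B" "costate A \<phi> r" y] zeros[OF r, of k]
        by (simp only: matrix_vector_mul_assoc inner_zero_left)
      then have "costate A \<phi> r \<bullet> (mexp A (r - s) *v (B *v y)) = 0"
        for s by (simp add: series)
      then have "\<phi> \<bullet> ((mexp A (- r) ** mexp A (r + - s)) *v (B *v y)) = 0"
        by (simp add: inner_costate matrix_vector_mul_assoc[symmetric])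
      then show ?thesis
        by (simp only: mexp_add inner_transpose inner_costate)
    qed
    then show ?thesis using inner_eq_zero_iff by blast
  qed
  with reachable_space_eq_0I assms(1,2) show False by blast
qed

lemma costate_nonzero: "\<phi> \<noteq> 0 \<Longrightarrow> costate A \<phi> t \<noteq> 0"
  using inner_costate[of A \<phi> t "mexp A t *v \<phi>"]
  by (auto simp: matrix_vector_mul_assoc mexp_inverse)

text \<open>
  To the left of a simple zero, \<open>q s\<close> behaves like \<open>(s - t) d\<close> with \<open>s - t < 0\<close>.
\<close>

lemma left_limit_of_sgn_at_simple_zero:
  fixes q :: "real \<Rightarrow> 'a::real_normed_vector"
  assumes d: "(q has_vector_derivative d) (at t)" and "q t = 0" "d \<noteq> 0"
  shows "((\<lambda>s. sgn (q s)) \<longlongrightarrow> - sgn d) (at_left t)"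
    and "eventually (\<lambda>s. q s \<noteq> 0) (at_left t)"
proof -
  \<comment> \<open>The remainder quotient tends to \<open>0\<close>; left of \<open>t\<close>, where the norm of \<open>s - t\<close> is \<open>t - s\<close>, it equals
      \<open>q s / (t - s) + d\<close>.\<close>
  let ?g = "\<lambda>s. (1 / norm (s - t)) *\<^sub>R (q s - (q t + (s - t) *\<^sub>R d))"
  have "(?g \<longlongrightarrow> 0) (at_left t)"
    using has_vector_derivative_at_within[OF d, of "{..<t}"]
    by (simp add: has_vector_derivative_def has_derivative_within)
  then have "((\<lambda>s. ?g s - d) \<longlongrightarrow> 0 - d) (at_left t)"
    by (rule tendsto_diff[OF _ tendsto_const])
  then have g: "((\<lambda>s. ?g s - d) \<longlongrightarrow> - d) (at_left t)" by (simp only: diff_0)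
  have left: "eventually (\<lambda>s. s < t) (at_left t)"
    by (simp add: eventually_at_filter)
  then have "eventually (\<lambda>s. ?g s - d = (1 / (t - s)) *\<^sub>R q s) (at_left t)"
  proof eventually_elim
    case (elim s)
    then have "norm (s - t) = t - s" and c: "(1 / (t - s)) * (s - t) = -1"
      by (simp_all add: field_simps)
    then have "?g s = (1 / (t - s)) *\<^sub>R q s - ((1 / (t - s)) * (s - t)) *\<^sub>R d"
      using \<open>q t = 0\<close> by (simp only: scaleR_diff_right scaleR_scaleR add_0_left)
    then show ?case by (simp only: c) simp
  qed
  with g have lim: "((\<lambda>s. (1 / (t - s)) *\<^sub>R q s) \<longlongrightarrow> - d) (at_left t)"
    by (rule Lim_transform_eventually)
  have "((\<lambda>s. sgn ((1 / (t - s)) *\<^sub>R q s)) \<longlongrightarrow> sgn (- d)) (at_left t)"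
    using lim \<open>d \<noteq> 0\<close> by (intro tendsto_sgn) auto
  moreover have "eventually (\<lambda>s. sgn ((1 / (t - s)) *\<^sub>R q s) = sgn (q s)) (at_left t)"
    using left by eventually_elim (simp add: sgn_scaleR)
  ultimately have "((\<lambda>s. sgn (q s)) \<longlongrightarrow> sgn (- d)) (at_left t)"
    by (rule Lim_transform_eventually)
  then show "((\<lambda>s. sgn (q s)) \<longlongrightarrow> - sgn d) (at_left t)" by (simp only: sgn_minus)
  have "eventually (\<lambda>s. (1 / (t - s)) *\<^sub>R q s \<noteq> 0) (at_left t)"
    using tendsto_imp_eventually_ne[OF lim, of 0] \<open>d \<noteq> 0\<close>
    by (simp only: neg_equal_0_iff_equal not_False_eq_True)
  then show "eventually (\<lambda>s. q s \<noteq> 0) (at_left t)"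
    by eventually_elim auto
qed

section \<open>Linear algebra of the controllability matrix\<close>

lemma mem_span_singleton_if_dim_1:
  fixes p v :: "'a::euclidean_space"
  assumes "subspace S" "dim S = 1" "p \<in> S" "p \<noteq> 0" "v \<in> S"
  obtains c where "v = c *\<^sub>R p"
proof -
  have "span {p} = S"
    using assms by (intro subspace_dim_equal) (auto simp: span_minimal)
  with \<open>v \<in> S\<close> that show ?thesis by (auto simp: span_singleton)
qed

lemma scaled_sgn_cases:
  "c \<noteq> 0 \<Longrightarrow> sgn (c *\<^sub>R p) \<in> {p /\<^sub>R norm p, - (p /\<^sub>R norm p)}"
  for p :: "'a::real_normed_vector"
  by (cases "c > 0") (auto simp: sgn_scaleR sgn_div_norm)

text \<open>
  The kernel of the transpose is the orthogonal complement of the range.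
\<close>

lemma dim_ker_transpose: "dim (ker (transpose B)) + rank B = CARD('n)"
  for B :: "real^'m^'n"
proof -
  have "ker (transpose B) = {y \<in> UNIV. \<forall>x \<in> range ((*v) B). orthogonal x y}"
  proof -
    have "transpose B *v y = 0 \<longleftrightarrow> (\<forall>x. y \<bullet> (B *v x) = 0)" for y
      by (metis inner_eq_zero_iff inner_zero_left inner_transpose)
    then show ?thesis
      by (simp add: ker_def orthogonal_def inner_commute)
  qed
  moreover have "subspace (range ((*v) B))"
    by (intro linear_subspace_image matrix_vector_mul_linear subspace_UNIV)
  ultimately show ?thesis
    using dim_subspace_orthogonal_to_vectors[of "range ((*v) B)" UNIV]
    by (simp add: rank_dim_range)
qed

text \<open>
  A vector \<open>y\<close> as in the second assumption is orthogonal to every column of the block matrix, and these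
  columns span the whole space.
\<close>

lemma kalman_rank_condition:
  fixes A :: "real^'n^'n" and B :: "real^'m^'n"
  assumes "rank (kalman_matrix A B) = CARD('n)"
    and "\<And>k. transpose (mpow A k ** B) *v y = 0"
  shows "y = 0"
proof -
  have "transpose (kalman_matrix A B) *v y = 0"
  proof (subst vec_eq_iff, rule allI)
    fix p
    have "(transpose (kalman_matrix A B) *v y) $ p =
        (transpose (mpow A (to_nat_on (UNIV :: 'n set) (fst p)) ** B) *v y) $ snd p"
      by (simp add: matrix_vector_mult_def transpose_def kalman_matrix_def funpow_matrix_mult)
    then show "(transpose (kalman_matrix A B) *v y) $ p = 0 $ p"
      using assms(2) by simp
  qed
  moreover have "inj ((*v) (transpose (kalman_matrix A B)))"
    using assms(1) by (simp only: full_rank_injective[symmetric] rank_transpose)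
  ultimately show ?thesis
    by (metis injD matrix_vector_mult_0_right)
qed

text \<open>
  Otherwise \<open>transpose A\<close> maps the line \<open>ker (transpose B)\<close> into itself, \<open>v\<close> is an eigenvector, and \<open>v\<close>
  is orthogonal to all columns of the matrices \<open>A\<^sup>k B\<close>, contradicting the rank condition.
\<close>

lemma controllable_imp_transpose_nonzero:
  fixes A :: "real^'n^'n" and B :: "real^'m^'n"
  assumes "rank (kalman_matrix A B) = CARD('n)" and dim: "dim (ker (transpose B)) = 1"
    and v: "v \<in> ker (transpose B)" "v \<noteq> 0"
  shows "transpose B *v (transpose A *v v) \<noteq> 0"
proof
  assume "transpose B *v (transpose A *v v) = 0"
  then have Av: "transpose A *v v \<in> ker (transpose B)" by (simp add: ker_def)
  have "subspace (ker (transpose B))"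
    unfolding ker_def by (rule linear_subspace_kernel[OF matrix_vector_mul_linear])
  then obtain c where c: "transpose A *v v = c *\<^sub>R v"
    using mem_span_singleton_if_dim_1[OF _ dim v Av] by blast
  have "transpose (mpow A k ** B) *v v = 0" for k
  proof (induction k)
    case 0
    then show ?case using v(1) by (simp add: ker_def)
  next
    case (Suc k)
    have "transpose (mpow A (Suc k) ** B) *v v = transpose (mpow A k ** B) *v (transpose A *v v)"
      by (simp only: mpow_Suc matrix_transpose_mul matrix_vector_mul_assoc matrix_mul_assoc)
    also have "\<dots> = c *\<^sub>R (transpose (mpow A k ** B) *v v)"
      by (simp only: c matrix_vector_mult_scaleR)
    finally show ?case by (simp only: Suc.IH scaleR_zero_right)
  qed
  with kalman_rank_condition[OF assms(1)] v(2) show False by blast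
qed

section \<open>Switching directions\<close>

text \<open>
  Arbitrarily close to a switching time from the left there are times at which the control is a
  normalised value of the switching function. These values lie in the range of \<open>transpose B\<close>, which is
  closed.
\<close>

lemma switching_direction_in_range:
  assumes u: "optimal_control A B x0 u"
    and v: "v \<in> switching_directions (optimal_time A B x0) u"
  shows "v \<in> range ((*v) (transpose B))"
proof -
  let ?T = "optimal_time A B x0" and ?R = "range ((*v) (transpose B))"
  obtain t where t: "0 < t" "t < ?T" and lim: "(u \<longlongrightarrow> v) (at_left t)"
    using v by (auto simp: switching_directions_def switching_points_def)
  obtain \<phi> where \<phi>: "\<phi> \<in> reachable_space A B" "\<phi> \<noteq> 0"
    and max: "\<And>s. \<lbrakk>0 < s; s < ?T; isCont u s; transpose B *v costate A \<phi> s \<noteq> 0\<rbrakk> \<Longrightarrow>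
      u s = sgn (transpose B *v costate A \<phi> s)"
    using maximum_principle[OF u less_trans[OF t]] by blast
  have "subspace ?R"
    by (intro linear_subspace_image matrix_vector_mul_linear subspace_UNIV)
  then have "closed ?R" by (rule closed_subspace)
  show ?thesis
  proof (rule ccontr)
    assume "v \<notin> ?R"
    with \<open>closed ?R\<close> lim have "eventually (\<lambda>s. u s \<in> - ?R) (at_left t)"
      by (intro topological_tendstoD) auto
    moreover have "eventually (isCont u) (at_left t)"
      using PC_eventually_isCont[of u "cball 0 1" t] u t
      by (auto simp: optimal_control_def intro: filter_leD[OF at_le])
    moreover have "eventually (\<lambda>s. s \<in> {0<..<t}) (at_left t)"
      using t by (intro eventually_at_left_real)
    ultimately have "eventually (\<lambda>s. u s \<notin> ?R \<and> isCont u s \<and> 0 < s) (at_left t)"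
      by eventually_elim auto
    then obtain b where b: "b < t" "\<And>s. b < s \<Longrightarrow> s < t \<Longrightarrow> u s \<notin> ?R \<and> isCont u s \<and> 0 < s"
      by (auto simp: eventually_at_left_field)
    obtain s where s: "b < s" "s < t" "transpose B *v costate A \<phi> s \<noteq> 0"
      using costate_nonzero_on_interval[OF \<phi> b(1)] .
    have "u s = sgn (transpose B *v costate A \<phi> s)"
      using b(2)[OF s(1,2)] s t by (intro max) auto
    also have "\<dots> \<in> ?R"
      unfolding sgn_div_norm by (intro subspace_scale[OF \<open>subspace ?R\<close>]) blast
    finally show False using b(2)[OF s(1,2)] by blast
  qed
qed

text \<open>
  At a switching time the switching function must vanish, so that the costate lies on the line
  \<open>ker (transpose B)\<close>. Since the costate never vanishes and the system is controllable, the derivative of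
  the switching function, a nonzero multiple of \<open>transpose B *v (transpose A *v v)\<close>, is nonzero, and
  its direction is, up to sign, the left limit of the control.
\<close>

lemma switching_direction_controllable:
  fixes A :: "real^'n^'n" and B :: "real^'m^'n"
  assumes u: "optimal_control A B x0 u"
    and kalman: "rank (kalman_matrix A B) = CARD('n)" and dim: "dim (ker (transpose B)) = 1"
    and v: "v \<in> ker (transpose B)" "v \<noteq> 0"
    and d: "d \<in> switching_directions (optimal_time A B x0) u"
  obtains c where "c \<noteq> 0" "d = sgn (c *\<^sub>R (transpose B *v (transpose A *v v)))"
proof -
  let ?T = "optimal_time A B x0" and ?p = "transpose B *v (transpose A *v v)"
  obtain t where t: "0 < t" "t < ?T" and switch: "switching_point u t"
    and lim: "(u \<longlongrightarrow> d) (at_left t)"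
    using d by (auto simp: switching_directions_def switching_points_def)
  obtain \<phi> where \<phi>: "\<phi> \<noteq> 0"
    and max: "\<And>s. \<lbrakk>0 < s; s < ?T; isCont u s; transpose B *v costate A \<phi> s \<noteq> 0\<rbrakk> \<Longrightarrow>
      u s = sgn (transpose B *v costate A \<phi> s)"
    using maximum_principle[OF u less_trans[OF t]] by blast
  define q where "q = (\<lambda>s. transpose B *v costate A \<phi> s)"
  have cont_u: "eventually (isCont u) (at t)"
    using PC_eventually_isCont[of u "cball 0 1" t] u t by (auto simp: optimal_control_def)
  have time: "eventually (\<lambda>s. 0 < s \<and> s < ?T) (at t)"
    using t by (intro eventually_conj order_tendstoD[OF tendsto_ident_at])
  have dq: "(q has_vector_derivative transpose B *v (- (transpose A *v costate A \<phi> t))) (at t)"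
    unfolding q_def
    by (rule bounded_linear.has_vector_derivative[OF bounded_linear_matrix_vector_right
          costate_has_vector_derivative])
  then have cont_q: "(q \<longlongrightarrow> q t) (at t)"
    using has_vector_derivative_continuous[OF dq] by (simp add: continuous_at)
  \<comment> \<open>Away from zeros of the switching function the control agrees with a continuous function.\<close>
  have "q t = 0"
  proof (rule ccontr)
    assume "q t \<noteq> 0"
    then have "eventually (\<lambda>s. q s \<noteq> 0) (at t)"
      using cont_q by (intro tendsto_imp_eventually_ne)
    with cont_u time have "eventually (\<lambda>s. sgn (q s) = u s) (at t)"
      by eventually_elim (simp add: q_def max)
    then have "(u \<longlongrightarrow> sgn (q t)) (at t)"
      using tendsto_sgn[OF cont_q \<open>q t \<noteq> 0\<close>] by (rule Lim_transform_eventually[rotated])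
    then have l: "(u \<longlongrightarrow> sgn (q t)) (at_left t)" and r: "(u \<longlongrightarrow> sgn (q t)) (at_right t)"
      by (auto simp: filterlim_at_split)
    from switch obtain r where "(u \<longlongrightarrow> u t) (at_left t)" "(u \<longlongrightarrow> r) (at_right t)" "u t \<noteq> r"
      by (auto simp: switching_point_def)
    with l r show False by (metis tendsto_unique trivial_limit_at_left_real trivial_limit_at_right_real)
  qed
  have "subspace (ker (transpose B))"
    unfolding ker_def by (rule linear_subspace_kernel[OF matrix_vector_mul_linear])
  moreover have "costate A \<phi> t \<in> ker (transpose B)"
    using \<open>q t = 0\<close> by (simp add: ker_def q_def)
  ultimately obtain c where c: "costate A \<phi> t = c *\<^sub>R v"
    using mem_span_singleton_if_dim_1[OF _ dim v] by blast
  then have "c \<noteq> 0" using costate_nonzero[OF \<phi>, of A t] by auto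
  have deriv: "(q has_vector_derivative - (c *\<^sub>R ?p)) (at t)"
    using dq by (simp only: c matrix_vector_mult_scaleR
        bounded_bilinear.minus_right[OF bounded_bilinear_matrix_vector_mult])
  have "- (c *\<^sub>R ?p) \<noteq> 0"
    using controllable_imp_transpose_nonzero[OF kalman dim v] \<open>c \<noteq> 0\<close> by simp
  note zero = left_limit_of_sgn_at_simple_zero[OF deriv \<open>q t = 0\<close> this]
  have "eventually (\<lambda>s. sgn (q s) = u s) (at_left t)"
    using filter_leD[OF at_le[OF subset_UNIV] cont_u, of "{..<t}"]
      filter_leD[OF at_le[OF subset_UNIV] time, of "{..<t}"] zero(2)
    by eventually_elim (simp add: q_def max)
  then have "(u \<longlongrightarrow> - sgn (- (c *\<^sub>R ?p))) (at_left t)"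
    using zero(1) by (rule Lim_transform_eventually[rotated])
  with lim have "d = sgn (c *\<^sub>R ?p)"
    using tendsto_unique[OF trivial_limit_at_left_real] by (metis minus_minus sgn_minus)
  with \<open>c \<noteq> 0\<close> show ?thesis by (rule that)
qed

theorem theorem4p1:
  fixes A :: "real^'n^'n" and B :: "real^'m^'n" and x0 :: "real^'n"
    and u :: "real \<Rightarrow> real^'m"
  assumes "B \<noteq> 0" and "x0 \<noteq> 0"
    and "\<exists>w. admissible_control A B x0 w"
    and "optimal_control A B x0 u"
    and "CARD('n) \<ge> 2"
    and "switching_points (optimal_time A B x0) u \<noteq> {}"
  shows "(rank B = 1 \<longrightarrow>
           (\<forall>v. v \<in> orthogonal_comp (ker (transpose B)) \<and> norm v = 1 \<longrightarrow>
             switching_directions (optimal_time A B x0) u \<subseteq>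
               {(transpose B *v v) /\<^sub>R norm (transpose B *v v),
                - ((transpose B *v v) /\<^sub>R norm (transpose B *v v))})) \<and>
         (rank (kalman_matrix A B) = CARD('n) \<and> rank B = CARD('n) - 1 \<longrightarrow>
           (\<forall>v. v \<in> ker (transpose B) \<and> norm v = 1 \<longrightarrow>
             switching_directions (optimal_time A B x0) u \<subseteq>
               {(transpose B *v (transpose A *v v)) /\<^sub>R norm (transpose B *v (transpose A *v v)),
                - ((transpose B *v (transpose A *v v)) /\<^sub>R norm (transpose B *v (transpose A *v v)))}))"
proof (intro conjI impI allI subsetI)
  fix v d
  let ?p = "transpose B *v v" and ?R = "range ((*v) (transpose B))"
  assume rank: "rank B = 1" and v: "v \<in> orthogonal_comp (ker (transpose B)) \<and> norm v = 1"
    and d: "d \<in> switching_directions (optimal_time A B x0) u"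
  have "?p \<noteq> 0"
  proof
    assume "?p = 0"
    then have "v \<bullet> v = 0"
      using v unfolding orthogonal_comp_def ker_def orthogonal_def by blast
    with v show False by simp
  qed
  have "subspace ?R"
    by (intro linear_subspace_image matrix_vector_mul_linear subspace_UNIV)
  moreover have "dim ?R = 1"
    using rank by (simp only: rank_dim_range[symmetric] rank_transpose)
  moreover have "d \<in> ?R"
    by (rule switching_direction_in_range[OF assms(4) d])
  ultimately obtain c where c: "d = c *\<^sub>R ?p"
    using mem_span_singleton_if_dim_1[of ?R ?p d] \<open>?p \<noteq> 0\<close> by blast
  have "norm d = 1" using d by (simp add: switching_directions_def)
  then have "c \<noteq> 0" and "d = sgn (c *\<^sub>R ?p)" using c by (auto simp: sgn_div_norm)
  then show "d \<in> {?p /\<^sub>R norm ?p, - (?p /\<^sub>R norm ?p)}"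
    using scaled_sgn_cases by metis
next
  fix v d
  let ?p = "transpose B *v (transpose A *v v)"
  assume rank: "rank (kalman_matrix A B) = CARD('n) \<and> rank B = CARD('n) - 1"
    and v: "v \<in> ker (transpose B) \<and> norm v = 1"
    and d: "d \<in> switching_directions (optimal_time A B x0) u"
  have "dim (ker (transpose B)) = 1"
    using dim_ker_transpose[of B] rank assms(5) by linarith
  moreover have "v \<noteq> 0" using v by auto
  ultimately obtain c where "c \<noteq> 0" "d = sgn (c *\<^sub>R ?p)"
    using switching_direction_controllable[OF assms(4) _ _ _ _ d] rank v by metis
  then show "d \<in> {?p /\<^sub>R norm ?p, - (?p /\<^sub>R norm ?p)}"
    using scaled_sgn_cases by metis
qed

end
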